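(* Let $S$ be a semiring, $T$ a multiplicatively closed subset of $S$, and $I$ a $k$-ideal of $S$. If $IS_T$ is a $k$-strongly irreducible ideal of $S_T$, then $IS_T\cap S$ is a $k$-strongly irreducible ideal of $S$.
   Context: A semiring is a commutative semiring $(S,+,0,\cdot,1)$ with multiplicative identity $1$ and additive identity $0$ that is absorbing. An ideal is a nonempty subset closed under addition and under multiplication by elements of $S$. A $k$-ideal is an ideal $I$ such that $x+y\in I$ and $y\in I$ imply $x\in I$. A $k$-ideal $I$ is $k$-strongly irreducible if for all $k$-ideals $A,B$ of the semiring, $A\cap B\subseteq I$ implies $A\subseteq I$ or $B\subseteq I$. A multiplicatively closed subset $T$ contains $1$ and is closed under products. $S_T=T^{-1}S$ is the usual semiring of fractions $x/s$ ($x\in S$, $s\in T$), with $x/s=y/t$ iff $uxt=uys$ for some $u\in T$. For an ideal $J$ of $S$, $JS_T=T^{-1}J=\{x/s: x\in J,s\in T\}$; for an ideal $L$ of $S_T$, $L\cap S$ means $\{x\in S: x/1\in L\}$. *)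

theory Defs
  imports "HOL-Algebra.Ring"
begin

locale csemiring = semiring + comm_monoid R

definition semiring_ideal :: "('a, 'm) ring_scheme \<Rightarrow> 'a set \<Rightarrow> bool" where
  "semiring_ideal R I \<longleftrightarrow>
     I \<subseteq> carrier R \<and> I \<noteq> {} \<and>
     (\<forall>x\<in>I. \<forall>y\<in>I. x \<oplus>\<^bsub>R\<^esub> y \<in> I) \<and>
     (\<forall>r\<in>carrier R. \<forall>x\<in>I. r \<otimes>\<^bsub>R\<^esub> x \<in> I)"

definition k_ideal :: "('a, 'm) ring_scheme \<Rightarrow> 'a set \<Rightarrow> bool" where
  "k_ideal R I \<longleftrightarrow>
     semiring_ideal R I \<and>
     (\<forall>x\<in>carrier R. \<forall>y\<in>carrier R. x \<oplus>\<^bsub>R\<^esub> y \<in> I \<longrightarrow> y \<in> I \<longrightarrow> x \<in> I)"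

text \<open>The whole semiring is not excluded: properness is not part of the notion.\<close>

definition k_strongly_irreducible :: "('a, 'm) ring_scheme \<Rightarrow> 'a set \<Rightarrow> bool" where
  "k_strongly_irreducible R I \<longleftrightarrow>
     k_ideal R I \<and>
     (\<forall>A B. k_ideal R A \<longrightarrow> k_ideal R B \<longrightarrow> A \<inter> B \<subseteq> I \<longrightarrow> A \<subseteq> I \<or> B \<subseteq> I)"

definition frac_rel :: "('a, 'm) ring_scheme \<Rightarrow> 'a set \<Rightarrow> (('a \<times> 'a) \<times> ('a \<times> 'a)) set" where
  "frac_rel S T = {((x, s), (y, t)).
     x \<in> carrier S \<and> s \<in> T \<and> y \<in> carrier S \<and> t \<in> T \<and>
     (\<exists>u\<in>T. u \<otimes>\<^bsub>S\<^esub> x \<otimes>\<^bsub>S\<^esub> t = u \<otimes>\<^bsub>S\<^esub> y \<otimes>\<^bsub>S\<^esub> s)}"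

definition frac :: "('a, 'm) ring_scheme \<Rightarrow> 'a set \<Rightarrow> 'a \<Rightarrow> 'a \<Rightarrow> ('a \<times> 'a) set" where
  "frac S T x s = frac_rel S T `` {(x, s)}"

text \<open>
  The operations on classes are unions over all representatives; by
  \<open>frac_add\<close> and \<open>frac_mult\<close> below every choice of representatives
  contributes the same class, so these are the usual sum and product of fractions.
\<close>

definition frac_semiring :: "('a, 'm) ring_scheme \<Rightarrow> 'a set \<Rightarrow> ('a \<times> 'a) set ring" where
  "frac_semiring S T =
     \<lparr> carrier = {frac S T x s | x s. x \<in> carrier S \<and> s \<in> T},
       monoid.mult = (\<lambda>X Y. \<Union>(x, s)\<in>X. \<Union>(y, t)\<in>Y. frac S T (x \<otimes>\<^bsub>S\<^esub> y) (s \<otimes>\<^bsub>S\<^esub> t)),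
       one = frac S T \<one>\<^bsub>S\<^esub> \<one>\<^bsub>S\<^esub>,
       zero = frac S T \<zero>\<^bsub>S\<^esub> \<one>\<^bsub>S\<^esub>,
       add = (\<lambda>X Y. \<Union>(x, s)\<in>X. \<Union>(y, t)\<in>Y.
                frac S T ((x \<otimes>\<^bsub>S\<^esub> t) \<oplus>\<^bsub>S\<^esub> (y \<otimes>\<^bsub>S\<^esub> s)) (s \<otimes>\<^bsub>S\<^esub> t)) \<rparr>"

definition ideal_ext :: "('a, 'm) ring_scheme \<Rightarrow> 'a set \<Rightarrow> 'a set \<Rightarrow> ('a \<times> 'a) set set" where
  "ideal_ext S T J = {frac S T x s | x s. x \<in> J \<and> s \<in> T}"

definition ideal_contr :: "('a, 'm) ring_scheme \<Rightarrow> 'a set \<Rightarrow> ('a \<times> 'a) set set \<Rightarrow> 'a set" where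
  "ideal_contr S T L = {x \<in> carrier S. frac S T x \<one>\<^bsub>S\<^esub> \<in> L}"

locale csemiring_frac = csemiring S + submonoid T S for S (structure) and T
begin

lemma T_carrier [simp]: "t \<in> T \<Longrightarrow> t \<in> carrier S"
  using subset by blast

lemma equiv_frac_rel: "equiv (carrier S \<times> T) (frac_rel S T)"
proof (rule equivI)
  show "frac_rel S T \<subseteq> (carrier S \<times> T) \<times> (carrier S \<times> T)"
    by (auto simp: frac_rel_def)
  show "refl_on (carrier S \<times> T) (frac_rel S T)"
    by (auto simp: refl_on_def frac_rel_def)
  show "sym (frac_rel S T)"
    unfolding sym_def frac_rel_def by (auto dest: sym)
  show "trans (frac_rel S T)"
  proof (rule transI)
    fix p q r assume "(p, q) \<in> frac_rel S T" "(q, r) \<in> frac_rel S T"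
    then obtain x s y t z w u v where
      [simp]: "p = (x, s)" "q = (y, t)" "r = (z, w)"
        "x \<in> carrier S" "y \<in> carrier S" "z \<in> carrier S" "s \<in> T" "t \<in> T" "w \<in> T" "u \<in> T" "v \<in> T"
      and 1: "u \<otimes> x \<otimes> t = u \<otimes> y \<otimes> s" and 2: "v \<otimes> y \<otimes> w = v \<otimes> z \<otimes> t"
      unfolding frac_rel_def by auto
    have "(u \<otimes> v \<otimes> t) \<otimes> x \<otimes> w = (u \<otimes> x \<otimes> t) \<otimes> (v \<otimes> w)" by (simp add: m_ac)
    also have "\<dots> = (v \<otimes> y \<otimes> w) \<otimes> (u \<otimes> s)" unfolding 1 by (simp add: m_ac)
    also have "\<dots> = (u \<otimes> v \<otimes> t) \<otimes> z \<otimes> s" unfolding 2 by (simp add: m_ac)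
    finally show "(p, r) \<in> frac_rel S T"
      unfolding frac_rel_def by (auto intro!: bexI[of _ "u \<otimes> v \<otimes> t"])
  qed
qed

lemma frac_eq_iff:
  assumes "x \<in> carrier S" "s \<in> T" "y \<in> carrier S" "t \<in> T"
  shows "frac S T x s = frac S T y t \<longleftrightarrow> (\<exists>u\<in>T. u \<otimes> x \<otimes> t = u \<otimes> y \<otimes> s)"
  unfolding frac_def using assms
  by (subst eq_equiv_class_iff[OF equiv_frac_rel]) (auto simp: frac_rel_def)

lemma frac_add:
  assumes "x \<in> carrier S" "s \<in> T" "y \<in> carrier S" "t \<in> T"
  shows "frac S T x s \<oplus>\<^bsub>frac_semiring S T\<^esub> frac S T y t
       = frac S T (x \<otimes> t \<oplus> y \<otimes> s) (s \<otimes> t)"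
proof -
  let ?f = "\<lambda>(x, s) (y, t). frac S T (x \<otimes> t \<oplus> y \<otimes> s) (s \<otimes> t)"
  have "?f respects2 frac_rel S T"
  proof (rule congruent2_commuteI[OF equiv_frac_rel])
    show "?f p q = ?f q p" if "p \<in> carrier S \<times> T" "q \<in> carrier S \<times> T" for p q
      using that by (auto simp: m_comm a_comm)
    show "?f r p = ?f r q" if r: "r \<in> carrier S \<times> T" and pq: "(p, q) \<in> frac_rel S T" for p q r
    proof -
      obtain x s y t u where
        [simp]: "p = (x, s)" "q = (y, t)"
          "x \<in> carrier S" "y \<in> carrier S" "s \<in> T" "t \<in> T" "u \<in> T"
        and 1: "u \<otimes> x \<otimes> t = u \<otimes> y \<otimes> s"
        using pq unfolding frac_rel_def by auto
      obtain z w where [simp]: "r = (z, w)" "z \<in> carrier S" "w \<in> T"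
        using r by auto
      have "u \<otimes> (z \<otimes> s \<oplus> x \<otimes> w) \<otimes> (w \<otimes> t)
          = u \<otimes> z \<otimes> s \<otimes> w \<otimes> t \<oplus> (u \<otimes> x \<otimes> t) \<otimes> (w \<otimes> w)"
        by (simp add: l_distr r_distr m_ac)
      also have "\<dots> = u \<otimes> (z \<otimes> t \<oplus> y \<otimes> w) \<otimes> (w \<otimes> s)"
        unfolding 1 by (simp add: l_distr r_distr m_ac)
      finally show ?thesis by (auto simp: frac_eq_iff intro!: bexI[of _ u])
    qed
  qed
  from UN_equiv_class2[OF equiv_frac_rel equiv_frac_rel this, of "(x, s)" "(y, t)"] assms
  show ?thesis by (simp add: frac_semiring_def frac_def split_def)
qed

lemma frac_mult:
  assumes "x \<in> carrier S" "s \<in> T" "y \<in> carrier S" "t \<in> T"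
  shows "frac S T x s \<otimes>\<^bsub>frac_semiring S T\<^esub> frac S T y t = frac S T (x \<otimes> y) (s \<otimes> t)"
proof -
  let ?f = "\<lambda>(x, s) (y, t). frac S T (x \<otimes> y) (s \<otimes> t)"
  have "?f respects2 frac_rel S T"
  proof (rule congruent2_commuteI[OF equiv_frac_rel])
    show "?f p q = ?f q p" if "p \<in> carrier S \<times> T" "q \<in> carrier S \<times> T" for p q
      using that by (auto simp: m_comm)
    show "?f r p = ?f r q" if r: "r \<in> carrier S \<times> T" and pq: "(p, q) \<in> frac_rel S T" for p q r
    proof -
      obtain x s y t u where
        [simp]: "p = (x, s)" "q = (y, t)"
          "x \<in> carrier S" "y \<in> carrier S" "s \<in> T" "t \<in> T" "u \<in> T"
        and 1: "u \<otimes> x \<otimes> t = u \<otimes> y \<otimes> s"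
        using pq unfolding frac_rel_def by auto
      obtain z w where [simp]: "r = (z, w)" "z \<in> carrier S" "w \<in> T"
        using r by auto
      have "u \<otimes> (z \<otimes> x) \<otimes> (w \<otimes> t) = (u \<otimes> x \<otimes> t) \<otimes> (z \<otimes> w)" by (simp add: m_ac)
      also have "\<dots> = u \<otimes> (z \<otimes> y) \<otimes> (w \<otimes> s)" unfolding 1 by (simp add: m_ac)
      finally show ?thesis by (auto simp: frac_eq_iff intro!: bexI[of _ u])
    qed
  qed
  from UN_equiv_class2[OF equiv_frac_rel equiv_frac_rel this, of "(x, s)" "(y, t)"] assms
  show ?thesis by (simp add: frac_semiring_def frac_def split_def)
qed

lemma csemiring_frac_semiring: "csemiring (frac_semiring S T)"
proof -
  let ?F = "frac_semiring S T"
  have CI: "frac S T x s \<in> carrier ?F" if "x \<in> carrier S" "s \<in> T" for x s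
    using that by (auto simp: frac_semiring_def)
  have CE: thesis if "X \<in> carrier ?F"
      "\<And>x s. X = frac S T x s \<Longrightarrow> x \<in> carrier S \<Longrightarrow> s \<in> T \<Longrightarrow> thesis" for X thesis
    using that by (auto simp: frac_semiring_def)
  have Z: "\<zero>\<^bsub>?F\<^esub> = frac S T \<zero> \<one>" and O: "\<one>\<^bsub>?F\<^esub> = frac S T \<one> \<one>"
    by (auto simp: frac_semiring_def)
  note fr = Z O frac_add frac_mult
  have cancel: "frac S T x s = frac S T y t"
    if "x \<in> carrier S" "s \<in> T" "y \<in> carrier S" "t \<in> T" "x \<otimes> t = y \<otimes> s" for x s y t
    using that by (auto elim!: CE intro!: CI simp: frac_eq_iff intro!: bexI[of _ \<one>])
  have "abelian_monoid ?F"
  proof (rule abelian_monoidI)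
    show "X \<oplus>\<^bsub>?F\<^esub> Y \<in> carrier ?F" if "X \<in> carrier ?F" "Y \<in> carrier ?F" for X Y
      using that by (elim CE) (simp add: fr CI)
    show "\<zero>\<^bsub>?F\<^esub> \<in> carrier ?F"
      by (simp add: fr CI)
    show "X \<oplus>\<^bsub>?F\<^esub> Y \<oplus>\<^bsub>?F\<^esub> Z = X \<oplus>\<^bsub>?F\<^esub> (Y \<oplus>\<^bsub>?F\<^esub> Z)"
      if "X \<in> carrier ?F" "Y \<in> carrier ?F" "Z \<in> carrier ?F" for X Y Z
      using that by (elim CE) (simp add: fr l_distr r_distr m_ac a_ac)
    show "\<zero>\<^bsub>?F\<^esub> \<oplus>\<^bsub>?F\<^esub> X = X" if "X \<in> carrier ?F" for X
      using that by (elim CE) (simp add: fr)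
    show "X \<oplus>\<^bsub>?F\<^esub> Y = Y \<oplus>\<^bsub>?F\<^esub> X" if "X \<in> carrier ?F" "Y \<in> carrier ?F" for X Y
      using that by (elim CE) (simp add: fr m_ac a_ac)
  qed
  moreover have cm: "comm_monoid ?F"
  proof (rule comm_monoidI)
    show "X \<otimes>\<^bsub>?F\<^esub> Y \<in> carrier ?F" if "X \<in> carrier ?F" "Y \<in> carrier ?F" for X Y
      using that by (elim CE) (simp add: fr CI)
    show "\<one>\<^bsub>?F\<^esub> \<in> carrier ?F"
      by (simp add: fr CI)
    show "X \<otimes>\<^bsub>?F\<^esub> Y \<otimes>\<^bsub>?F\<^esub> Z = X \<otimes>\<^bsub>?F\<^esub> (Y \<otimes>\<^bsub>?F\<^esub> Z)"
      if "X \<in> carrier ?F" "Y \<in> carrier ?F" "Z \<in> carrier ?F" for X Y Z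
      using that by (elim CE) (simp add: fr m_ac)
    show "\<one>\<^bsub>?F\<^esub> \<otimes>\<^bsub>?F\<^esub> X = X" if "X \<in> carrier ?F" for X
      using that by (elim CE) (simp add: fr)
    show "X \<otimes>\<^bsub>?F\<^esub> Y = Y \<otimes>\<^bsub>?F\<^esub> X" if "X \<in> carrier ?F" "Y \<in> carrier ?F" for X Y
      using that by (elim CE) (simp add: fr m_ac)
  qed
  moreover have "semiring_axioms ?F"
  proof
    fix X Y Z assume "X \<in> carrier ?F" "Y \<in> carrier ?F" "Z \<in> carrier ?F"
    then obtain x s y t z w where [simp]:
      "X = frac S T x s" "Y = frac S T y t" "Z = frac S T z w"
      "x \<in> carrier S" "y \<in> carrier S" "z \<in> carrier S" "s \<in> T" "t \<in> T" "w \<in> T"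
      by (elim CE)
    show "(X \<oplus>\<^bsub>?F\<^esub> Y) \<otimes>\<^bsub>?F\<^esub> Z = X \<otimes>\<^bsub>?F\<^esub> Z \<oplus>\<^bsub>?F\<^esub> Y \<otimes>\<^bsub>?F\<^esub> Z"
      by (simp add: fr, rule cancel) (simp_all add: l_distr r_distr m_ac)
    show "Z \<otimes>\<^bsub>?F\<^esub> (X \<oplus>\<^bsub>?F\<^esub> Y) = Z \<otimes>\<^bsub>?F\<^esub> X \<oplus>\<^bsub>?F\<^esub> Z \<otimes>\<^bsub>?F\<^esub> Y"
      by (simp add: fr, rule cancel) (simp_all add: l_distr r_distr m_ac)
  next
    fix X assume "X \<in> carrier ?F"
    then obtain x s where [simp]: "X = frac S T x s" "x \<in> carrier S" "s \<in> T"
      by (elim CE)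
    show "\<zero>\<^bsub>?F\<^esub> \<otimes>\<^bsub>?F\<^esub> X = \<zero>\<^bsub>?F\<^esub>" "X \<otimes>\<^bsub>?F\<^esub> \<zero>\<^bsub>?F\<^esub> = \<zero>\<^bsub>?F\<^esub>"
      by (simp_all add: fr, (rule cancel; simp)+)
  qed
  ultimately show ?thesis
    by (intro csemiring.intro semiring.intro comm_monoid.axioms(1)[OF cm])
qed

end

end

theory Submission
  imports Defs
begin

text \<open>
  Extension to the fractions and contraction back both preserve \<open>k\<close>-ideals. Moreover,
  extension preserves intersections: if \<open>a/s = b/t\<close> with \<open>a \<in> A\<close>, \<open>b \<in> B\<close>, then some
  \<open>uat = ubs\<close> lies in \<open>A \<inter> B\<close>. So an inclusion of \<open>A \<inter> B\<close> in the contraction of \<open>L\<close>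
  puts the intersection of the extensions inside \<open>L\<close>, and irreducibility
  of \<open>L\<close> descends to its contraction.
\<close>

lemma semiring_idealD:
  assumes "semiring_ideal R I"
  shows "I \<subseteq> carrier R" "I \<noteq> {}"
    "x \<in> I \<Longrightarrow> y \<in> I \<Longrightarrow> x \<oplus>\<^bsub>R\<^esub> y \<in> I"
    "r \<in> carrier R \<Longrightarrow> x \<in> I \<Longrightarrow> r \<otimes>\<^bsub>R\<^esub> x \<in> I"
  using assms by (auto simp: semiring_ideal_def)

lemma k_idealD:
  assumes "k_ideal R I"
  shows "semiring_ideal R I"
    "x \<oplus>\<^bsub>R\<^esub> y \<in> I \<Longrightarrow> y \<in> I \<Longrightarrow> x \<in> carrier R \<Longrightarrow> y \<in> carrier R \<Longrightarrow> x \<in> I"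
  using assms by (auto simp: k_ideal_def)

context csemiring_frac
begin

lemma frac_in_carrier [simp]:
  "x \<in> carrier S \<Longrightarrow> s \<in> T \<Longrightarrow> frac S T x s \<in> carrier (frac_semiring S T)"
  by (auto simp: frac_semiring_def)

lemma frac_carrierE:
  assumes "X \<in> carrier (frac_semiring S T)"
  obtains x s where "X = frac S T x s" "x \<in> carrier S" "s \<in> T"
  using assms by (auto simp: frac_semiring_def)

lemma frac_in_ideal_ext: "x \<in> J \<Longrightarrow> s \<in> T \<Longrightarrow> frac S T x s \<in> ideal_ext S T J"
  by (auto simp: ideal_ext_def)

text \<open>Membership in the extension only says that some representative has its numerator in
  \<open>J\<close>; the given numerator \<open>x\<close> may lie outside. This criterion works with
  any chosen representative, and the later proofs use it to pass from fractions to elements of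
  \<open>S\<close>.\<close>

lemma frac_in_ideal_ext_iff:
  assumes J: "semiring_ideal S J" and x: "x \<in> carrier S" "s \<in> T"
  shows "frac S T x s \<in> ideal_ext S T J \<longleftrightarrow> (\<exists>u\<in>T. u \<otimes> x \<in> J)"
proof
  assume "frac S T x s \<in> ideal_ext S T J"
  then obtain y t where y: "y \<in> J" "t \<in> T" and eq: "frac S T x s = frac S T y t"
    by (auto simp: ideal_ext_def)
  have yc: "y \<in> carrier S" using semiring_idealD(1)[OF J] y by auto
  obtain u where u: "u \<in> T" "u \<otimes> x \<otimes> t = u \<otimes> y \<otimes> s"
    using eq x y yc by (auto simp: frac_eq_iff)
  \<comment> \<open>Regrouping \<open>u x t = u y s\<close> shows that \<open>u t\<close> is a
    multiplier in \<open>T\<close> carrying \<open>x\<close> to a multiple of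
    \<open>y\<close>.\<close>
  have "(u \<otimes> t) \<otimes> x = (u \<otimes> s) \<otimes> y"
    using u x y yc by (simp add: m_ac)
  also have "\<dots> \<in> J"
    using semiring_idealD(4)[OF J] u x y by simp
  finally show "\<exists>u\<in>T. u \<otimes> x \<in> J" using u y by (auto intro!: bexI[of _ "u \<otimes> t"])
next
  assume "\<exists>u\<in>T. u \<otimes> x \<in> J"
  then obtain u where u: "u \<in> T" "u \<otimes> x \<in> J" by blast
  \<comment> \<open>Expanding the fraction by \<open>u\<close> moves its numerator into
    \<open>J\<close>.\<close>
  have "frac S T x s = frac S T (u \<otimes> x) (u \<otimes> s)"
    using u x by (auto simp: frac_eq_iff m_ac intro!: bexI[of _ \<one>])
  then show "frac S T x s \<in> ideal_ext S T J"
    using u x by (auto simp: ideal_ext_def)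
qed

lemma semiring_ideal_ext:
  assumes J: "semiring_ideal S J"
  shows "semiring_ideal (frac_semiring S T) (ideal_ext S T J)"
  unfolding semiring_ideal_def
proof (intro conjI ballI)
  note JD = semiring_idealD[OF J]
  have Jc: "x \<in> carrier S" if "x \<in> J" for x using JD(1) that by auto
  show "ideal_ext S T J \<subseteq> carrier (frac_semiring S T)"
    by (auto simp: ideal_ext_def Jc)
  show "ideal_ext S T J \<noteq> {}"
    using JD(2) frac_in_ideal_ext[OF _ one_closed] by blast
  fix Y assume "Y \<in> ideal_ext S T J"
  then obtain y t where Y: "Y = frac S T y t" "y \<in> J" "t \<in> T" by (auto simp: ideal_ext_def)
  show "X \<oplus>\<^bsub>frac_semiring S T\<^esub> Y \<in> ideal_ext S T J" if X: "X \<in> ideal_ext S T J" for X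
  proof -
    obtain x s where X: "X = frac S T x s" "x \<in> J" "s \<in> T"
      using X by (auto simp: ideal_ext_def)
    \<comment> \<open>\<open>semiring_ideal\<close> gives closure under left multiplication, so the
      factors are swapped first and then put back into the order used by
      \<open>frac_add\<close>.\<close>
    have "t \<otimes> x \<oplus> s \<otimes> y \<in> J" using X Y JD(3,4) by simp
    then have "x \<otimes> t \<oplus> y \<otimes> s \<in> J" using X Y by (simp add: Jc m_comm)
    then show ?thesis using X Y by (auto simp: Jc frac_add ideal_ext_def)
  qed
  show "X \<otimes>\<^bsub>frac_semiring S T\<^esub> Y \<in> ideal_ext S T J" if "X \<in> carrier (frac_semiring S T)" for X
    using that
  proof (rule frac_carrierE)
    fix x s assume X: "X = frac S T x s" "x \<in> carrier S" "s \<in> T"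
    have "x \<otimes> y \<in> J" using X Y JD(4) by simp
    then show ?thesis using X Y by (auto simp: Jc frac_mult ideal_ext_def)
  qed
qed

text \<open>The subtraction property is applied in \<open>S\<close>: one common multiplier from
  \<open>T\<close> brings both the numerator of the sum and its \<open>y\<close>-summand into
  \<open>J\<close>, and then a multiple of \<open>x\<close> by an element of \<open>T\<close> is
  left.\<close>

lemma k_ideal_ext:
  assumes J: "k_ideal S J"
  shows "k_ideal (frac_semiring S T) (ideal_ext S T J)"
  unfolding k_ideal_def
proof (intro conjI ballI impI)
  note JI = k_idealD(1)[OF J]
  note JD = semiring_idealD[OF JI]
  show "semiring_ideal (frac_semiring S T) (ideal_ext S T J)"
    by (rule semiring_ideal_ext[OF JI])
  fix X Y assume "X \<in> carrier (frac_semiring S T)" "Y \<in> carrier (frac_semiring S T)"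
    and sum: "X \<oplus>\<^bsub>frac_semiring S T\<^esub> Y \<in> ideal_ext S T J" and YJ: "Y \<in> ideal_ext S T J"
  then obtain x s y t where X: "X = frac S T x s" "x \<in> carrier S" "s \<in> T"
    and Y: "Y = frac S T y t" "y \<in> carrier S" "t \<in> T"
    by (elim frac_carrierE)
  obtain u where u: "u \<in> T" "u \<otimes> (x \<otimes> t \<oplus> y \<otimes> s) \<in> J"
    using sum X Y by (auto simp: frac_add frac_in_ideal_ext_iff[OF JI])
  obtain v where v: "v \<in> T" "v \<otimes> y \<in> J"
    using YJ Y by (auto simp: frac_in_ideal_ext_iff[OF JI])
  \<comment> \<open>The extra factor \<open>v\<close> turns the second summand into a multiple of
    \<open>v y\<close>, which is known to lie in \<open>J\<close>.\<close>
  have "v \<otimes> (u \<otimes> (x \<otimes> t \<oplus> y \<otimes> s)) \<in> J"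
    using u v JD(4) by simp
  then have 1: "(u \<otimes> v \<otimes> t) \<otimes> x \<oplus> (u \<otimes> s) \<otimes> (v \<otimes> y) \<in> J"
    using u v X Y by (simp add: r_distr m_ac)
  have 2: "(u \<otimes> s) \<otimes> (v \<otimes> y) \<in> J"
    using u v X JD(4) by simp
  have "(u \<otimes> v \<otimes> t) \<otimes> x \<in> J"
    by (rule k_idealD(2)[OF J 1 2]) (use u v X Y in simp_all)
  then show "X \<in> ideal_ext S T J"
    using u v X Y by (auto simp: frac_in_ideal_ext_iff[OF JI] intro!: bexI[of _ "u \<otimes> v \<otimes> t"])
qed

text \<open>The contraction is the preimage of \<open>L\<close> under x \<mapsto> x/1, which
  respects sums and products (\<open>add1\<close>, \<open>mult1\<close>), so each closure property
  is pulled back from \<open>L\<close>.\<close>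

lemma k_ideal_contr:
  assumes L: "k_ideal (frac_semiring S T) L"
  shows "k_ideal S (ideal_contr S T L)"
proof -
  interpret F: csemiring "frac_semiring S T" by (rule csemiring_frac_semiring)
  note LD = semiring_idealD[OF k_idealD(1)[OF L]]
  have add1: "frac S T (x \<oplus> y) \<one> = frac S T x \<one> \<oplus>\<^bsub>frac_semiring S T\<^esub> frac S T y \<one>"
    if "x \<in> carrier S" "y \<in> carrier S" for x y
    using that by (simp add: frac_add)
  have mult1: "frac S T (x \<otimes> y) \<one> = frac S T x \<one> \<otimes>\<^bsub>frac_semiring S T\<^esub> frac S T y \<one>"
    if "x \<in> carrier S" "y \<in> carrier S" for x y
    using that by (simp add: frac_mult)
  \<comment> \<open>Nonemptiness needs an element of \<open>L\<close> of the form x/1. Zero serves,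
    being a multiple of any element of \<open>L\<close>.\<close>
  obtain X where "X \<in> L" using LD(2) by blast
  then have "\<zero>\<^bsub>frac_semiring S T\<^esub> \<otimes>\<^bsub>frac_semiring S T\<^esub> X \<in> L" "X \<in> carrier (frac_semiring S T)"
    using LD(1,4) by auto
  then have "\<zero>\<^bsub>frac_semiring S T\<^esub> \<in> L" by simp
  then have "\<zero> \<in> ideal_contr S T L"
    by (simp add: ideal_contr_def frac_semiring_def)
  then show ?thesis
    unfolding k_ideal_def semiring_ideal_def
    by (auto simp: ideal_contr_def add1 mult1 LD intro: k_idealD(2)[OF L])
qed

lemma ideal_ext_Int_subset:
  assumes A: "semiring_ideal S A" and B: "semiring_ideal S B"
  shows "ideal_ext S T A \<inter> ideal_ext S T B \<subseteq> ideal_ext S T (A \<inter> B)"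
proof
  fix X assume X: "X \<in> ideal_ext S T A \<inter> ideal_ext S T B"
  then have "X \<in> carrier (frac_semiring S T)"
    using semiring_idealD(1)[OF semiring_ideal_ext[OF A]] by auto
  then obtain x s where x: "X = frac S T x s" "x \<in> carrier S" "s \<in> T"
    by (rule frac_carrierE)
  obtain u v where u: "u \<in> T" "u \<otimes> x \<in> A" and v: "v \<in> T" "v \<otimes> x \<in> B"
    using X x by (auto simp: frac_in_ideal_ext_iff A B)
  \<comment> \<open>Both extensions are tested on the same representative x/s. Multiplying each
    numerator by the other multiplier gives one element \<open>u v x\<close> lying in
    \<open>A\<close> and in \<open>B\<close>.\<close>
  have "v \<otimes> (u \<otimes> x) \<in> A" "u \<otimes> (v \<otimes> x) \<in> B"
    using u v semiring_idealD(4)[OF A] semiring_idealD(4)[OF B] by auto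
  then have "u \<otimes> v \<otimes> x \<in> A \<inter> B"
    using u v x by (simp add: m_ac)
  moreover have "X = frac S T (u \<otimes> v \<otimes> x) (u \<otimes> v \<otimes> s)"
    using u v x by (auto simp: frac_eq_iff m_ac intro!: bexI[of _ \<one>])
  ultimately show "X \<in> ideal_ext S T (A \<inter> B)"
    using u v x by (auto simp: ideal_ext_def)
qed

text \<open>Extension and contraction form a Galois connection. It is what translates inclusions
  between \<open>S\<close> and the fractions in both directions in the main argument.\<close>

lemma ideal_ext_subset_iff:
  assumes L: "semiring_ideal (frac_semiring S T) L" and J: "J \<subseteq> carrier S"
  shows "ideal_ext S T J \<subseteq> L \<longleftrightarrow> J \<subseteq> ideal_contr S T L"
proof
  assume "ideal_ext S T J \<subseteq> L"
  then have "frac S T x \<one> \<in> L" if "x \<in> J" for x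
    using that frac_in_ideal_ext[OF _ one_closed] by blast
  then show "J \<subseteq> ideal_contr S T L"
    using J by (auto simp: ideal_contr_def)
next
  assume sub: "J \<subseteq> ideal_contr S T L"
  show "ideal_ext S T J \<subseteq> L"
  proof
    fix X assume "X \<in> ideal_ext S T J"
    then obtain x s where x: "X = frac S T x s" "x \<in> J" "s \<in> T"
      by (auto simp: ideal_ext_def)
    then have xc: "x \<in> carrier S" and "frac S T x \<one> \<in> L"
      using J sub by (auto simp: ideal_contr_def)
    \<comment> \<open>x/s is the multiple of x/1 by the scalar 1/s.\<close>
    then have "frac S T \<one> s \<otimes>\<^bsub>frac_semiring S T\<^esub> frac S T x \<one> \<in> L"
      using x by (intro semiring_idealD(4)[OF L]) simp_all
    then show "X \<in> L" using x xc by (simp add: frac_mult)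
  qed
qed

lemma k_strongly_irreducible_contr:
  assumes L: "k_strongly_irreducible (frac_semiring S T) L"
  shows "k_strongly_irreducible S (ideal_contr S T L)"
  unfolding k_strongly_irreducible_def
proof (intro conjI allI impI)
  have Lk: "k_ideal (frac_semiring S T) L"
    using L by (simp add: k_strongly_irreducible_def)
  show "k_ideal S (ideal_contr S T L)" by (rule k_ideal_contr[OF Lk])
  fix A B assume A: "k_ideal S A" and B: "k_ideal S B" and AB: "A \<inter> B \<subseteq> ideal_contr S T L"
  note AI = k_idealD(1)[OF A] and BI = k_idealD(1)[OF B]
  note sub_iff = ideal_ext_subset_iff[OF k_idealD(1)[OF Lk]]
  have Ac: "A \<subseteq> carrier S" and Bc: "B \<subseteq> carrier S"
    using semiring_idealD(1) AI BI by blast+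
  \<comment> \<open>The Galois connection carries the inclusion up to the fractions, where
    \<open>L\<close> is irreducible; at the end it brings the chosen alternative back down.\<close>
  have "ideal_ext S T (A \<inter> B) \<subseteq> L"
    using AB Ac by (subst sub_iff) auto
  then have "ideal_ext S T A \<inter> ideal_ext S T B \<subseteq> L"
    using ideal_ext_Int_subset[OF AI BI] by simp
  then have "ideal_ext S T A \<subseteq> L \<or> ideal_ext S T B \<subseteq> L"
    using L k_ideal_ext[OF A] k_ideal_ext[OF B] by (simp add: k_strongly_irreducible_def)
  then show "A \<subseteq> ideal_contr S T L \<or> B \<subseteq> ideal_contr S T L"
    by (simp add: sub_iff Ac Bc)
qed

end

theorem proposition5p8:
  fixes S :: "('a, 'm) ring_scheme" (structure) and T I :: "'a set"
  assumes "csemiring S"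
    and "submonoid T S"
    and "k_ideal S I"
    and "k_strongly_irreducible (frac_semiring S T) (ideal_ext S T I)"
  shows "k_strongly_irreducible S (ideal_contr S T (ideal_ext S T I))"
  using csemiring_frac.k_strongly_irreducible_contr[OF csemiring_frac.intro] assms by blast

end
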